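(* Let $(M,g)$ be a pseudo-Riemannian manifold and let $J_1$, $J_2$ be two $(1,1)$-tensor fields on $M$ satisfying the following conditions: (i) $J_1J_2=J_2J_1$; (ii) $(J_1+J_2)^3-(J_1+J_2)+I=0$; (iii) $g(J_1X,Y)=g(X,J_1Y)$ for all $X,Y\in\Gamma^\infty(TM)$; (iv) $g(J_2X,Y)=g(X,J_2Y)$ for all $X,Y\in\Gamma^\infty(TM)$. Then $$\hat J:=\begin{pmatrix} J_1 & (I-J_1J_2-J_1^2-J_2^2)g^{-1}\\ g & J_2^*\end{pmatrix}$$ is a generalized almost plastic structure on $M$, i.e. $\hat J^3-\hat J-I=0$.
   Context: $\Gamma^\infty(E)$ denotes the smooth sections of a bundle $E$ over the smooth manifold $M$, and $I$ the identity. The pseudo-Riemannian metric $g$ is also regarded as the flat isomorphism $g:\Gamma^\infty(TM)\to\Gamma^\infty(T^*M)$, $g(X):=i_Xg=g(X,\cdot)$, with inverse $g^{-1}$. For a $(1,1)$-tensor field $J$, $J^*:\Gamma^\infty(T^*M)\to\Gamma^\infty(T^*M)$ is $J^*(\eta)(X):=\eta(JX)$. The block matrix notation means $\hat J(X+\eta)=\big(J_1X+(I-J_1J_2-J_1^2-J_2^2)g^{-1}(\eta)\big)+\big(g(X)+J_2^*(\eta)\big)$ for $X\in\Gamma^\infty(TM)$, $\eta\in\Gamma^\infty(T^*M)$. A generalized almost plastic structure on $M$ is a morphism $\hat J:\Gamma^\infty(TM\oplus T^*M)\to\Gamma^\infty(TM\oplus T^*M)$ with $\hat J^3-\hat J-I=0$.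 *)

theory Defs
  imports "HOL-Analysis.Analysis" "HOL-Library.Function_Algebras"
begin

text \<open>
  Conventions. Addition, subtraction and zero of tangent vectors, of sections and of operators are
  the pointwise ones of \<^theory>\<open>HOL-Library.Function_Algebras\<close>. Sections vanish
  off the carrier, covectors vanish off the tangent space, so that equality of sections is equality
  in HOL.
\<close>

subsection \<open>Smooth maps between open subsets of normed spaces\<close>

text \<open>Both notions are meant for open \<open>S\<close> in a finite-dimensional space, where existence and
  continuity of all directional derivatives up to order \<open>k\<close> is the usual class \<open>C\<^sup>k\<close>.\<close>

primrec Ck_on :: "nat \<Rightarrow> ('x::real_normed_vector \<Rightarrow> 'y::real_normed_vector) \<Rightarrow> 'x set \<Rightarrow> bool" where
  "Ck_on 0 f S \<longleftrightarrow> continuous_on S f"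
| "Ck_on (Suc k) f S \<longleftrightarrow> (\<forall>x\<in>S. f differentiable (at x)) \<and>
     (\<forall>u. Ck_on k (\<lambda>x. frechet_derivative f (at x) u) S)"

definition smooth_on :: "('x::real_normed_vector \<Rightarrow> 'y::real_normed_vector) \<Rightarrow> 'x set \<Rightarrow> bool" where
  "smooth_on f S \<longleftrightarrow> (\<forall>k. Ck_on k f S)"

subsection \<open>Smooth manifolds\<close>

text \<open>A chart is a pair of its domain and its coordinate map; only the values of the coordinate
  map on the domain matter.\<close>

type_synonym ('a, 'n) chart = "'a set \<times> ('a \<Rightarrow> real ^ 'n)"

definition chart_image :: "('a, 'n::finite) chart \<Rightarrow> (real ^ 'n) set" where
  "chart_image c = snd c ` fst c"

definition chart_inv :: "('a, 'n::finite) chart \<Rightarrow> real ^ 'n \<Rightarrow> 'a" where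
  "chart_inv c = inv_into (fst c) (snd c)"

definition transition :: "('a, 'n::finite) chart \<Rightarrow> ('a, 'n) chart \<Rightarrow> real ^ 'n \<Rightarrow> real ^ 'n" where
  "transition c d = snd d \<circ> chart_inv c"

record ('a, 'n) manifold =
  mtop :: "'a topology"
  atlas :: "('a, 'n) chart set"

abbreviation carrier :: "('a, 'n::finite) manifold \<Rightarrow> 'a set" where
  "carrier M \<equiv> topspace (mtop M)"

text \<open>The atlas is not required to be maximal: it determines the smooth structure.\<close>

definition smooth_manifold :: "('a, 'n::finite) manifold \<Rightarrow> bool" where
  "smooth_manifold M \<longleftrightarrow>
     Hausdorff_space (mtop M) \<and> second_countable (mtop M) \<and>
     (\<Union>c\<in>atlas M. fst c) = carrier M \<and>
     (\<forall>c\<in>atlas M. openin (mtop M) (fst c) \<and> open (chart_image c) \<and>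
        homeomorphic_map (subtopology (mtop M) (fst c)) (top_of_set (chart_image c)) (snd c)) \<and>
     (\<forall>c\<in>atlas M. \<forall>d\<in>atlas M. smooth_on (transition c d) (snd c ` (fst c \<inter> fst d)))"

definition smooth_functions :: "('a, 'n::finite) manifold \<Rightarrow> ('a \<Rightarrow> real) set" where
  "smooth_functions M = {f. \<forall>c\<in>atlas M. smooth_on (f \<circ> chart_inv c) (chart_image c)}"

definition charts_at :: "('a, 'n::finite) manifold \<Rightarrow> 'a \<Rightarrow> ('a, 'n) chart set" where
  "charts_at M p = {c \<in> atlas M. p \<in> fst c}"

subsection \<open>Tangent vectors and covectors\<close>

text \<open>A tangent vector at \<open>p\<close> is the family of its coordinate representations in the charts
  around \<open>p\<close>, related by the derivatives of the transition maps.\<close>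

type_synonym ('a, 'n) tvec = "('a, 'n) chart \<Rightarrow> real ^ 'n"
type_synonym ('a, 'n) covec = "('a, 'n) tvec \<Rightarrow> real"

definition tangent_space :: "('a, 'n::finite) manifold \<Rightarrow> 'a \<Rightarrow> ('a, 'n) tvec set" where
  "tangent_space M p = {v.
     (\<forall>c\<in>charts_at M p. \<forall>d\<in>charts_at M p.
        v d = frechet_derivative (transition c d) (at (snd c p)) (v c)) \<and>
     (\<forall>c. c \<notin> charts_at M p \<longrightarrow> v c = 0)}"

definition tscale :: "real \<Rightarrow> ('a, 'n::finite) tvec \<Rightarrow> ('a, 'n) tvec" where
  "tscale r v = (\<lambda>c. r *\<^sub>R v c)"

text \<open>The tangent vector at \<open>p\<close> whose representation in the chart \<open>c\<close> around \<open>p\<close> is \<open>u\<close>. For basis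
  vectors \<open>u\<close> these are the coordinate vectors of \<open>c\<close>.\<close>

definition coord_vec :: "('a, 'n::finite) manifold \<Rightarrow> ('a, 'n) chart \<Rightarrow> 'a \<Rightarrow> real ^ 'n \<Rightarrow> ('a, 'n) tvec" where
  "coord_vec M c p u =
     (\<lambda>d. if d \<in> charts_at M p then frechet_derivative (transition c d) (at (snd c p)) u else 0)"

definition cotangent_space :: "('a, 'n::finite) manifold \<Rightarrow> 'a \<Rightarrow> ('a, 'n) covec set" where
  "cotangent_space M p = {\<alpha>.
     (\<forall>v\<in>tangent_space M p. \<forall>w\<in>tangent_space M p. \<alpha> (v + w) = \<alpha> v + \<alpha> w) \<and>
     (\<forall>r. \<forall>v\<in>tangent_space M p. \<alpha> (tscale r v) = r * \<alpha> v) \<and>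
     (\<forall>v. v \<notin> tangent_space M p \<longrightarrow> \<alpha> v = 0)}"

subsection \<open>Smooth sections and tensor fields\<close>

definition vector_fields :: "('a, 'n::finite) manifold \<Rightarrow> ('a \<Rightarrow> ('a, 'n) tvec) set" where
  "vector_fields M = {X.
     (\<forall>p\<in>carrier M. X p \<in> tangent_space M p) \<and> (\<forall>p. p \<notin> carrier M \<longrightarrow> X p = 0) \<and>
     (\<forall>c\<in>atlas M. smooth_on (\<lambda>x. X (chart_inv c x) c) (chart_image c))}"

definition one_forms :: "('a, 'n::finite) manifold \<Rightarrow> ('a \<Rightarrow> ('a, 'n) covec) set" where
  "one_forms M = {\<eta>.
     (\<forall>p\<in>carrier M. \<eta> p \<in> cotangent_space M p) \<and> (\<forall>p. p \<notin> carrier M \<longrightarrow> \<eta> p = 0) \<and>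
     (\<forall>c\<in>atlas M. \<forall>u. smooth_on
        (\<lambda>x. \<eta> (chart_inv c x) (coord_vec M c (chart_inv c x) u)) (chart_image c))}"

definition tensor_field_11 ::
  "('a, 'n::finite) manifold \<Rightarrow> ('a \<Rightarrow> ('a, 'n) tvec \<Rightarrow> ('a, 'n) tvec) \<Rightarrow> bool" where
  "tensor_field_11 M J \<longleftrightarrow>
     (\<forall>p\<in>carrier M. \<forall>v\<in>tangent_space M p. J p v \<in> tangent_space M p \<and>
        (\<forall>w\<in>tangent_space M p. J p (v + w) = J p v + J p w) \<and>
        (\<forall>r. J p (tscale r v) = tscale r (J p v))) \<and>
     (\<forall>c\<in>atlas M. \<forall>u. smooth_on
        (\<lambda>x. J (chart_inv c x) (coord_vec M c (chart_inv c x) u) c) (chart_image c))"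

definition pseudo_Riemannian_metric ::
  "('a, 'n::finite) manifold \<Rightarrow> ('a \<Rightarrow> ('a, 'n) tvec \<Rightarrow> ('a, 'n) tvec \<Rightarrow> real) \<Rightarrow> bool" where
  "pseudo_Riemannian_metric M g \<longleftrightarrow>
     (\<forall>p\<in>carrier M. \<forall>v\<in>tangent_space M p.
        (\<forall>w\<in>tangent_space M p. g p v w = g p w v \<and>
           (\<forall>w'\<in>tangent_space M p. g p v (w + w') = g p v w + g p v w') \<and>
           (\<forall>r. g p v (tscale r w) = r * g p v w)) \<and>
        ((\<forall>w\<in>tangent_space M p. g p v w = 0) \<longrightarrow> v = 0)) \<and>
     (\<forall>c\<in>atlas M. \<forall>u w. smooth_on
        (\<lambda>x. g (chart_inv c x) (coord_vec M c (chart_inv c x) u) (coord_vec M c (chart_inv c x) w))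
        (chart_image c))"

subsection \<open>Operators on sections\<close>

definition act :: "('a, 'n::finite) manifold \<Rightarrow> ('a \<Rightarrow> ('a, 'n) tvec \<Rightarrow> ('a, 'n) tvec) \<Rightarrow>
    ('a \<Rightarrow> ('a, 'n) tvec) \<Rightarrow> ('a \<Rightarrow> ('a, 'n) tvec)" where
  "act M J X = (\<lambda>p. if p \<in> carrier M then J p (X p) else 0)"

definition dual_act :: "('a, 'n::finite) manifold \<Rightarrow> ('a \<Rightarrow> ('a, 'n) tvec \<Rightarrow> ('a, 'n) tvec) \<Rightarrow>
    ('a \<Rightarrow> ('a, 'n) covec) \<Rightarrow> ('a \<Rightarrow> ('a, 'n) covec)" where
  "dual_act M J \<eta> = (\<lambda>p v. if p \<in> carrier M \<and> v \<in> tangent_space M p then \<eta> p (J p v) else 0)"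

definition flat :: "('a, 'n::finite) manifold \<Rightarrow> ('a \<Rightarrow> ('a, 'n) tvec \<Rightarrow> ('a, 'n) tvec \<Rightarrow> real) \<Rightarrow>
    ('a \<Rightarrow> ('a, 'n) tvec) \<Rightarrow> ('a \<Rightarrow> ('a, 'n) covec)" where
  "flat M g X = (\<lambda>p v. if p \<in> carrier M \<and> v \<in> tangent_space M p then g p (X p) v else 0)"

definition sharp :: "('a, 'n::finite) manifold \<Rightarrow> ('a \<Rightarrow> ('a, 'n) tvec \<Rightarrow> ('a, 'n) tvec \<Rightarrow> real) \<Rightarrow>
    ('a \<Rightarrow> ('a, 'n) covec) \<Rightarrow> ('a \<Rightarrow> ('a, 'n) tvec)" where
  "sharp M g = inv_into (vector_fields M) (flat M g)"

subsection \<open>The generalized tangent bundle\<close>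

text \<open>The section \<open>X + \<eta>\<close> of the Whitney sum of the tangent and cotangent bundles is the pair
  \<open>(X, \<eta>)\<close>.\<close>

type_synonym ('a, 'n) gsection = "('a \<Rightarrow> ('a, 'n) tvec) \<times> ('a \<Rightarrow> ('a, 'n) covec)"

definition gsections :: "('a, 'n::finite) manifold \<Rightarrow> ('a, 'n) gsection set" where
  "gsections M = vector_fields M \<times> one_forms M"

definition gscale :: "('a \<Rightarrow> real) \<Rightarrow> ('a, 'n::finite) gsection \<Rightarrow> ('a, 'n) gsection" where
  "gscale f s = (\<lambda>p. tscale (f p) (fst s p), \<lambda>p v. f p * snd s p v)"

text \<open>Bundle morphisms over the identity, as maps of sections linear over the smooth functions.\<close>

definition gmorphism :: "('a, 'n::finite) manifold \<Rightarrow> (('a, 'n) gsection \<Rightarrow> ('a, 'n) gsection) \<Rightarrow> bool" where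
  "gmorphism M F \<longleftrightarrow>
     F \<in> gsections M \<rightarrow> gsections M \<and>
     (\<forall>s\<in>gsections M. \<forall>t\<in>gsections M. F (s + t) = F s + F t) \<and>
     (\<forall>f\<in>smooth_functions M. \<forall>s\<in>gsections M. F (gscale f s) = gscale f (F s))"

definition generalized_almost_plastic ::
  "('a, 'n::finite) manifold \<Rightarrow> (('a, 'n) gsection \<Rightarrow> ('a, 'n) gsection) \<Rightarrow> bool" where
  "generalized_almost_plastic M F \<longleftrightarrow>
     gmorphism M F \<and> (\<forall>s\<in>gsections M. (F ^^ 3) s - F s - s = 0)"

definition block_matrix ::
  "(('a \<Rightarrow> ('a, 'n::finite) tvec) \<Rightarrow> ('a \<Rightarrow> ('a, 'n) tvec)) \<Rightarrow>
   (('a \<Rightarrow> ('a, 'n) covec) \<Rightarrow> ('a \<Rightarrow> ('a, 'n) tvec)) \<Rightarrow>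
   (('a \<Rightarrow> ('a, 'n) tvec) \<Rightarrow> ('a \<Rightarrow> ('a, 'n) covec)) \<Rightarrow>
   (('a \<Rightarrow> ('a, 'n) covec) \<Rightarrow> ('a \<Rightarrow> ('a, 'n) covec)) \<Rightarrow>
   ('a, 'n) gsection \<Rightarrow> ('a, 'n) gsection" where
  "block_matrix A B C D s = (A (fst s) + B (snd s), C (fst s) + D (snd s))"

end

theory Submission
  imports Defs
begin

text \<open>
  Flat is an isomorphism from vector fields to one-forms, so every section of the generalized
  tangent bundle is \<open>(X, Z\<^sup>\<flat>)\<close> for unique vector fields \<open>X\<close>, \<open>Z\<close>. Self-adjointness of \<open>J\<^sub>2\<close> says that
  flat intertwines \<open>J\<^sub>2\<close> with its dual. In terms of \<open>(X, Z)\<close> the block matrix therefore becomes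
  \<open>(J\<^sub>1, P; I, J\<^sub>2)\<close> with \<open>P = I - J\<^sub>1 J\<^sub>2 - J\<^sub>1\<^sup>2 - J\<^sub>2\<^sup>2\<close>, a matrix with entries in the commutative algebra
  generated by \<open>J\<^sub>1\<close> and \<open>J\<^sub>2\<close>. Its trace is \<open>T = J\<^sub>1 + J\<^sub>2\<close> and its determinant is
  \<open>J\<^sub>1 J\<^sub>2 - P = T\<^sup>2 - I\<close>. By Cayley--Hamilton a matrix \<open>A\<close> with this trace and determinant satisfies
  \<open>A\<^sup>2 = T A - (T\<^sup>2 - I)\<close>, hence \<open>A\<^sup>3 = A - (T\<^sup>3 - T)\<close>, and the hypothesis \<open>T\<^sup>3 - T + I = 0\<close> turns this
  into \<open>A\<^sup>3 = A + I\<close> (\<open>block_cubic\<close>).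

  The analytic content lies in the two facts about flat. It is onto the smooth one-forms
  (\<open>flat_surj\<close>): at each point by nondegeneracy, and smoothly because Cramer's rule gives the
  coordinates of the solution as quotients of determinants of smooth functions. The intertwining
  (\<open>dual_act_flat\<close>) is an identity of covectors, tested on all tangent vectors, while self-adjointness
  is given for global vector fields; they are linked by the existence of a vector field through each
  tangent vector (\<open>vector_field_through\<close>), which requires a smooth bump function.
\<close>

section \<open>Calculus of \<open>C\<^sup>k\<close> maps\<close>

lemma Ck_on_Suc_has_derivative:
  assumes "Ck_on (Suc k) f S" "x \<in> S"
  shows "(f has_derivative frechet_derivative f (at x)) (at x)"
  using assms frechet_derivative_works by auto

lemma Ck_on_cong:
  assumes "open S" "\<And>x. x \<in> S \<Longrightarrow> f x = g x" "Ck_on k f S"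
  shows "Ck_on k g S"
  using assms(2,3)
proof (induction k arbitrary: f g)
  case 0
  then show ?case by (metis Ck_on.simps(1) continuous_on_cong)
next
  case (Suc k)
  have g: "(g has_derivative frechet_derivative f (at x)) (at x)" if "x \<in> S" for x
    using has_derivative_transform_within_open[OF Ck_on_Suc_has_derivative[OF Suc.prems(2) that] \<open>open S\<close> that]
      Suc.prems(1) by blast
  have eq: "frechet_derivative f (at x) u = frechet_derivative g (at x) u" if "x \<in> S" for x u
    using frechet_derivative_at[OF g[OF that]] by simp
  have "Ck_on k (\<lambda>x. frechet_derivative g (at x) u) S" for u
    by (rule Suc.IH[of "\<lambda>x. frechet_derivative f (at x) u"]) (use eq Suc.prems in auto)
  then show ?case
    using differentiableI[OF g] by simp
qed

lemma Ck_on_SucI: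
  assumes "open S" "\<And>x. x \<in> S \<Longrightarrow> (f has_derivative f' x) (at x)"
    and "\<And>u. Ck_on k (\<lambda>x. f' x u) S"
  shows "Ck_on (Suc k) f S"
proof -
  have "Ck_on k (\<lambda>x. frechet_derivative f (at x) u) S" for u
    by (rule Ck_on_cong[OF assms(1) _ assms(3)[of u]])
      (metis assms(2) frechet_derivative_at)
  then show ?thesis
    using differentiableI[OF assms(2)] by simp
qed

lemma Ck_on_Suc_imp: "Ck_on (Suc k) f S \<Longrightarrow> Ck_on k f S"
proof (induction k arbitrary: f)
  case 0
  then show ?case
    by (auto simp: continuous_on_eq_continuous_within
        intro: differentiable_imp_continuous_within differentiable_at_withinI)
qed simp

lemma Ck_on_subset: "Ck_on k f S \<Longrightarrow> T \<subseteq> S \<Longrightarrow> Ck_on k f T"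
  by (induction k arbitrary: f) (auto intro: continuous_on_subset)

text \<open>Differentiability at interior points is local, and so is continuity, hence the class can be
  tested on an open cover.\<close>

lemma Ck_on_local:
  assumes "\<And>x. x \<in> S \<Longrightarrow> \<exists>U. open U \<and> x \<in> U \<and> Ck_on k f U"
  shows "Ck_on k f S"
  using assms
proof (induction k arbitrary: f)
  case 0
  then show ?case
    by (metis Ck_on.simps(1) continuous_at_imp_continuous_on continuous_on_eq_continuous_at)
next
  case (Suc k)
  have "Ck_on k (\<lambda>x. frechet_derivative f (at x) u) S" for u
    by (rule Suc.IH) (use Suc.prems in fastforce)
  moreover have "f differentiable (at x)" if "x \<in> S" for x
    using Suc.prems[OF that] by auto
  ultimately show ?case by simp
qed

lemma Ck_on_const: "open S \<Longrightarrow> Ck_on k (\<lambda>x. c) S"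
proof (induction k arbitrary: c)
  case (Suc k)
  show ?case
    by (rule Ck_on_SucI[OF Suc.prems, where f' = "\<lambda>x u. 0"]) (use Suc in auto)
qed simp

lemma Ck_on_add:
  assumes "open S" "Ck_on k f S" "Ck_on k g S"
  shows "Ck_on k (\<lambda>x. f x + g x) S"
  using assms(2,3)
proof (induction k arbitrary: f g)
  case (Suc k)
  show ?case
  proof (rule Ck_on_SucI[OF assms(1)])
    fix x assume "x \<in> S"
    then show "((\<lambda>x. f x + g x) has_derivative
        (\<lambda>u. frechet_derivative f (at x) u + frechet_derivative g (at x) u)) (at x)"
      by (intro has_derivative_add) (use Suc.prems Ck_on_Suc_has_derivative in blast)+
  qed (use Suc in auto)
qed (auto intro: continuous_intros)

lemma Ck_on_bounded_linear:
  assumes "open S" "bounded_linear h" "Ck_on k f S"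
  shows "Ck_on k (\<lambda>x. h (f x)) S"
  using assms(3)
proof (induction k arbitrary: f)
  case 0
  then show ?case
    using bounded_linear.continuous_on[OF assms(2)] by auto
next
  case (Suc k)
  show ?case
  proof (rule Ck_on_SucI[OF assms(1)])
    fix x assume "x \<in> S"
    then show "((\<lambda>x. h (f x)) has_derivative (\<lambda>u. h (frechet_derivative f (at x) u))) (at x)"
      by (intro bounded_linear.has_derivative[OF assms(2)])
        (use Suc.prems Ck_on_Suc_has_derivative in blast)
  qed (use Suc in auto)
qed

lemma Ck_on_bilinear:
  assumes "open S" "bounded_bilinear B" "Ck_on k f S" "Ck_on k g S"
  shows "Ck_on k (\<lambda>x. B (f x) (g x)) S"
  using assms(3,4)
proof (induction k arbitrary: f g)
  case 0
  then show ?case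
    using bounded_bilinear.continuous_on[OF assms(2)] by auto
next
  case (Suc k)
  have f: "Ck_on k f S" and g: "Ck_on k g S"
    using Suc.prems by (auto intro: Ck_on_Suc_imp simp del: Ck_on.simps)
  show ?case
  proof (rule Ck_on_SucI[OF assms(1)])
    fix x assume "x \<in> S"
    then show "((\<lambda>x. B (f x) (g x)) has_derivative
        (\<lambda>u. B (f x) (frechet_derivative g (at x) u) + B (frechet_derivative f (at x) u) (g x))) (at x)"
      by (intro bounded_bilinear.FDERIV[OF assms(2)]) (use Suc.prems Ck_on_Suc_has_derivative in blast)+
  next
    fix u
    show "Ck_on k (\<lambda>x. B (f x) (frechet_derivative g (at x) u) + B (frechet_derivative f (at x) u) (g x)) S"
      by (intro Ck_on_add[OF assms(1)] Suc.IH f g) (use Suc.prems in auto)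
  qed
qed

lemma Ck_on_sum:
  "open S \<Longrightarrow> (\<And>i. i \<in> I \<Longrightarrow> Ck_on k (f i) S) \<Longrightarrow> Ck_on k (\<lambda>x. \<Sum>i\<in>I. f i x) S"
  by (induction I rule: infinite_finite_induct) (simp_all add: Ck_on_const Ck_on_add)

lemma Ck_on_inverse:
  fixes f :: "'x::real_normed_vector \<Rightarrow> real"
  assumes "open S" "\<And>x. x \<in> S \<Longrightarrow> f x \<noteq> 0" "Ck_on k f S"
  shows "Ck_on k (\<lambda>x. inverse (f x)) S"
  using assms(3)
proof (induction k)
  case 0
  then show ?case
    using assms by (auto intro: continuous_intros)
next
  case (Suc k)
  have f: "Ck_on k (\<lambda>x. inverse (f x)) S"
    using Suc by (auto intro: Ck_on_Suc_imp simp del: Ck_on.simps)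
  show ?case
  proof (rule Ck_on_SucI[OF assms(1)])
    fix x assume "x \<in> S"
    then show "((\<lambda>x. inverse (f x)) has_derivative
        (\<lambda>u. - (inverse (f x) * frechet_derivative f (at x) u * inverse (f x)))) (at x)"
      by (intro Deriv.has_derivative_inverse) (use Suc.prems assms Ck_on_Suc_has_derivative in blast)+
  next
    fix u
    show "Ck_on k (\<lambda>x. - (inverse (f x) * frechet_derivative f (at x) u * inverse (f x))) S"
      by (intro Ck_on_bounded_linear[OF assms(1) bounded_linear_minus[OF bounded_linear_ident]]
          Ck_on_bilinear[OF assms(1) bounded_bilinear_mult] f) (use Suc.prems in auto)
  qed
qed

text \<open>The induction needs the derivative of \<open>g\<close> in a fixed direction, whereas the chain rule
  produces it in the moving direction \<open>Df(x) u\<close>; expanding that direction in an orthonormal basis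
  separates the two.\<close>

lemma Ck_on_compose:
  fixes f :: "'x::real_normed_vector \<Rightarrow> 'y::euclidean_space" and g :: "'y \<Rightarrow> 'z::real_normed_vector"
  assumes "open S" "open T" "f ` S \<subseteq> T" "Ck_on k f S" "Ck_on k g T"
  shows "Ck_on k (\<lambda>x. g (f x)) S"
  using assms(4,5)
proof (induction k arbitrary: g)
  case 0
  then show ?case
    using assms(3) continuous_on_compose2 by (metis Ck_on.simps(1))
next
  case (Suc k)
  let ?D = "\<lambda>x u. \<Sum>b\<in>Basis. (frechet_derivative f (at x) u \<bullet> b) *\<^sub>R frechet_derivative g (at (f x)) b"
  show ?case
  proof (rule Ck_on_SucI[OF assms(1)])
    fix x assume x: "x \<in> S"
    have g: "(g has_derivative frechet_derivative g (at (f x))) (at (f x))"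
      using Suc.prems assms(3) x Ck_on_Suc_has_derivative by blast
    have "(\<lambda>u. frechet_derivative g (at (f x)) (frechet_derivative f (at x) u)) = ?D x"
    proof
      fix u
      have "linear (frechet_derivative g (at (f x)))"
        using g has_derivative_linear by blast
      then show "frechet_derivative g (at (f x)) (frechet_derivative f (at x) u) = ?D x u"
        by (subst euclidean_representation[symmetric, of "frechet_derivative f (at x) u"])
          (simp add: linear_sum linear_scale)
    qed
    then show "((\<lambda>x. g (f x)) has_derivative ?D x) (at x)"
      using has_derivative_compose[OF Ck_on_Suc_has_derivative[OF Suc.prems(1) x] g] by simp
  next
    fix u
    have f: "Ck_on k f S"
      using Suc.prems by (auto intro: Ck_on_Suc_imp simp del: Ck_on.simps)
    have "Ck_on k (\<lambda>x. frechet_derivative f (at x) u \<bullet> b) S" for b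
      by (intro Ck_on_bounded_linear[OF assms(1) bounded_linear_inner_left]) (use Suc.prems in simp)
    then show "Ck_on k (\<lambda>x. ?D x u) S"
      by (intro Ck_on_sum[OF assms(1)] Ck_on_bilinear[OF assms(1) bounded_bilinear_scaleR] Suc.IH f)
        (use Suc.prems in auto)
  qed
qed

section \<open>Smooth maps\<close>

lemma smooth_on_cong:
  "open S \<Longrightarrow> (\<And>x. x \<in> S \<Longrightarrow> f x = g x) \<Longrightarrow> smooth_on f S \<Longrightarrow> smooth_on g S"
  unfolding smooth_on_def using Ck_on_cong by blast

lemma smooth_on_subset: "smooth_on f S \<Longrightarrow> T \<subseteq> S \<Longrightarrow> smooth_on f T"
  unfolding smooth_on_def using Ck_on_subset by blast

lemma smooth_on_local:
  "(\<And>x. x \<in> S \<Longrightarrow> \<exists>U. open U \<and> x \<in> U \<and> smooth_on f U) \<Longrightarrow> smooth_on f S"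
  unfolding smooth_on_def by (meson Ck_on_local)

lemma smooth_on_const: "open S \<Longrightarrow> smooth_on (\<lambda>x. c) S"
  unfolding smooth_on_def using Ck_on_const by blast

lemma smooth_on_add:
  "open S \<Longrightarrow> smooth_on f S \<Longrightarrow> smooth_on g S \<Longrightarrow> smooth_on (\<lambda>x. f x + g x) S"
  unfolding smooth_on_def using Ck_on_add by blast

lemma smooth_on_sum:
  "open S \<Longrightarrow> (\<And>i. i \<in> I \<Longrightarrow> smooth_on (f i) S) \<Longrightarrow> smooth_on (\<lambda>x. \<Sum>i\<in>I. f i x) S"
  by (induction I rule: infinite_finite_induct) (simp_all add: smooth_on_const smooth_on_add)

lemma smooth_on_bounded_linear:
  "open S \<Longrightarrow> bounded_linear h \<Longrightarrow> smooth_on f S \<Longrightarrow> smooth_on (\<lambda>x. h (f x)) S"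
  unfolding smooth_on_def using Ck_on_bounded_linear by blast

lemma smooth_on_bilinear:
  "open S \<Longrightarrow> bounded_bilinear B \<Longrightarrow> smooth_on f S \<Longrightarrow> smooth_on g S \<Longrightarrow>
    smooth_on (\<lambda>x. B (f x) (g x)) S"
  unfolding smooth_on_def using Ck_on_bilinear by blast

lemmas smooth_on_scaleR = smooth_on_bilinear[OF _ bounded_bilinear_scaleR]
lemmas smooth_on_mult = smooth_on_bilinear[OF _ bounded_bilinear_mult]
lemmas smooth_on_inner = smooth_on_bilinear[OF _ bounded_bilinear_inner]
lemmas smooth_on_minus = smooth_on_bounded_linear[OF _ bounded_linear_minus[OF bounded_linear_ident]]
lemmas smooth_on_vec_nth = smooth_on_bounded_linear[OF _ bounded_linear_vec_nth]

lemma smooth_on_diff: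
  assumes "open S" "smooth_on f S" "smooth_on g S"
  shows "smooth_on (\<lambda>x. f x - g x) S"
  using smooth_on_add[OF assms(1,2) smooth_on_minus[OF assms(1,3)]] by simp

lemma smooth_on_prod:
  fixes f :: "'i \<Rightarrow> 'x::real_normed_vector \<Rightarrow> real"
  shows "open S \<Longrightarrow> (\<And>i. i \<in> I \<Longrightarrow> smooth_on (f i) S) \<Longrightarrow> smooth_on (\<lambda>x. \<Prod>i\<in>I. f i x) S"
  by (induction I rule: infinite_finite_induct) (simp_all add: smooth_on_const smooth_on_mult)

lemma smooth_on_divide:
  fixes f :: "'x::real_normed_vector \<Rightarrow> real"
  assumes "open S" "smooth_on f S" "smooth_on g S" "\<And>x. x \<in> S \<Longrightarrow> g x \<noteq> 0"
  shows "smooth_on (\<lambda>x. f x / g x) S"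
proof -
  have "smooth_on (\<lambda>x. inverse (g x)) S"
    using assms Ck_on_inverse unfolding smooth_on_def by blast
  from smooth_on_mult[OF assms(1,2) this] show ?thesis
    by (simp add: divide_inverse)
qed

lemma smooth_on_compose:
  fixes f :: "'x::real_normed_vector \<Rightarrow> 'y::euclidean_space"
  shows "open S \<Longrightarrow> open T \<Longrightarrow> f ` S \<subseteq> T \<Longrightarrow> smooth_on f S \<Longrightarrow> smooth_on g T \<Longrightarrow>
    smooth_on (\<lambda>x. g (f x)) S"
  unfolding smooth_on_def using Ck_on_compose by blast

lemma smooth_on_frechet_derivative:
  "smooth_on f S \<Longrightarrow> smooth_on (\<lambda>x. frechet_derivative f (at x) u) S"
  unfolding smooth_on_def using Ck_on.simps(2) by blast

lemma smooth_on_has_derivative: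
  "smooth_on f S \<Longrightarrow> x \<in> S \<Longrightarrow> (f has_derivative frechet_derivative f (at x)) (at x)"
  unfolding smooth_on_def using Ck_on_Suc_has_derivative by blast

lemma smooth_on_id: 
  assumes "open S" shows "smooth_on (\<lambda>x. x) S"
proof -
  have "Ck_on k (\<lambda>x. x) S" for k
  proof (cases k)
    case (Suc l)
    show ?thesis unfolding Suc
      by (rule Ck_on_SucI[OF assms, where f' = "\<lambda>x u. u"]) (auto intro: Ck_on_const assms)
  qed simp
  then show ?thesis by (simp add: smooth_on_def)
qed

lemma smooth_on_vecI:
  fixes f :: "'x::real_normed_vector \<Rightarrow> real ^ 'n"
  assumes "open S" "\<And>i. smooth_on (\<lambda>x. f x $ i) S"
  shows "smooth_on f S"
proof (rule smooth_on_cong[OF assms(1)])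
  show "smooth_on (\<lambda>x. \<Sum>i\<in>UNIV. (f x $ i) *\<^sub>R axis i 1) S"
    by (intro smooth_on_sum smooth_on_scaleR smooth_on_const assms)
  show "(\<Sum>i\<in>UNIV. (f x $ i) *\<^sub>R axis i 1) = f x" for x
    by (simp add: vec_eq_iff axis_def if_distrib cong: if_cong)
qed

lemma smooth_on_det:
  fixes A :: "'x::real_normed_vector \<Rightarrow> real ^ 'n ^ 'n"
  assumes "open S" "\<And>i j. smooth_on (\<lambda>x. A x $ i $ j) S"
  shows "smooth_on (\<lambda>x. det (A x)) S"
  unfolding det_def by (intro smooth_on_sum smooth_on_mult smooth_on_prod smooth_on_const assms)

text \<open>Cramer's rule writes each component of \<open>v\<close> as a quotient of determinants.\<close>

lemma smooth_on_linear_solution: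
  fixes A :: "'x::real_normed_vector \<Rightarrow> real ^ 'n ^ 'n" and v b :: "'x \<Rightarrow> real ^ 'n"
  assumes "open S" "\<And>i j. smooth_on (\<lambda>x. A x $ i $ j) S" "\<And>i. smooth_on (\<lambda>x. b x $ i) S"
    and "\<And>x. x \<in> S \<Longrightarrow> det (A x) \<noteq> 0" "\<And>x. x \<in> S \<Longrightarrow> A x *v v x = b x"
  shows "smooth_on v S"
proof (rule smooth_on_vecI[OF assms(1)])
  fix k
  let ?B = "\<lambda>x. (\<chi> i j. if j = k then b x $ i else A x $ i $ j) :: real ^ 'n ^ 'n"
  have "smooth_on (\<lambda>x. det (?B x)) S"
  proof (rule smooth_on_det[OF assms(1)])
    fix i j
    show "smooth_on (\<lambda>x. ?B x $ i $ j) S"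
      using assms(2,3) by (cases "j = k") auto
  qed
  then have "smooth_on (\<lambda>x. det (?B x) / det (A x)) S"
    by (rule smooth_on_divide[OF assms(1)]) (intro smooth_on_det assms(1,2), fact assms(4))
  then show "smooth_on (\<lambda>x. v x $ k) S"
    by (rule smooth_on_cong[OF assms(1), rotated]) (use cramer[of "A _"] assms(4,5) in force)
qed

section \<open>A smooth function supported on a ball\<close>

text \<open>The function wanted is the member \<open>n = 0\<close>, which is \<open>exp (-1/x)\<close> on the positive axis. The
  family is there because the derivative of each member is a linear combination of members, so
  that a single induction shows that all of them are smooth.\<close>

definition flat_exp :: "nat \<Rightarrow> real \<Rightarrow> real" where
  "flat_exp n x = (if x > 0 then (1 / x) ^ n * exp (- (1 / x)) else 0)"

lemma flat_exp_tendsto_0: "(flat_exp n \<longlongrightarrow> 0) (at 0)"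
proof -
  have "((\<lambda>x. (1 / x) ^ n * exp (- (1 / x))) \<longlongrightarrow> (0::real)) (at_right 0)"
  proof -
    have "filterlim (\<lambda>x::real. 1 / x) at_top (at_right 0)"
      using filterlim_inverse_at_top_right by (simp add: inverse_eq_divide)
    from filterlim_compose[OF tendsto_power_div_exp_0 this] show ?thesis
      by (simp add: exp_minus divide_inverse)
  qed
  then have "(flat_exp n \<longlongrightarrow> 0) (at_right 0)"
    by (rule Lim_transform_eventually)
      (auto simp: flat_exp_def eventually_at_right_less eventually_at_filter)
  moreover have "(flat_exp n \<longlongrightarrow> 0) (at_left 0)"
    by (rule Lim_transform_eventually[where f = "\<lambda>x. 0"])
      (auto simp: flat_exp_def eventually_at_filter)
  ultimately show ?thesis
    using filterlim_split_at_real by blast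
qed

lemma flat_exp_DERIV:
  "(flat_exp n has_field_derivative (flat_exp (n + 2) x - of_nat n * flat_exp (n + 1) x)) (at x)"
proof -
  consider "x > 0" | "x < 0" | "x = 0" by linarith
  then show ?thesis
  proof cases
    case 1
    have "((\<lambda>x. (1 / x) ^ n * exp (- (1 / x))) has_field_derivative
        (flat_exp (n + 2) x - of_nat n * flat_exp (n + 1) x)) (at x)"
      using 1 by (cases n)
       (auto intro!: derivative_eq_intros simp: flat_exp_def field_simps power2_eq_square,
        metis One_nat_def mult.commute neq0_conv power_minus_mult)
    then show ?thesis
      by (rule has_field_derivative_transform_within_open[where S = "{0<..}"]) (use 1 in \<open>auto simp: flat_exp_def\<close>)
  next
    case 2
    have "((\<lambda>x. 0) has_field_derivative (flat_exp (n + 2) x - of_nat n * flat_exp (n + 1) x)) (at x)"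
      using 2 by (simp add: flat_exp_def)
    then show ?thesis
      by (rule has_field_derivative_transform_within_open[where S = "{..<0}"]) (use 2 in \<open>auto simp: flat_exp_def\<close>)
  next
    case 3
    \<comment> \<open>Dividing by \<open>h\<close> raises the index by one.\<close>
    have "(\<lambda>h. (flat_exp n (0 + h) - flat_exp n 0) / h) = flat_exp (n + 1)"
      by (auto simp: flat_exp_def fun_eq_iff)
    then show ?thesis
      using flat_exp_tendsto_0[of "n + 1"] unfolding 3 DERIV_def by (simp add: flat_exp_def)
  qed
qed

lemma smooth_on_flat_exp: "smooth_on (flat_exp n) UNIV"
proof -
  have "Ck_on k (flat_exp n) UNIV" for k
  proof (induction k arbitrary: n)
    case 0
    show ?case
      using flat_exp_DERIV DERIV_isCont continuous_at_imp_continuous_on by (metis Ck_on.simps(1))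
  next
    case (Suc k)
    show ?case
    proof (rule Ck_on_SucI)
      fix x
      show "(flat_exp n has_derivative
          (\<lambda>u. (flat_exp (n + 2) x + (- of_nat n) * flat_exp (n + 1) x) * u)) (at x)"
        using flat_exp_DERIV[of n x] by (simp add: has_field_derivative_def)
    next
      fix u :: real
      show "Ck_on k (\<lambda>x. (flat_exp (n + 2) x + (- of_nat n) * flat_exp (n + 1) x) * u) UNIV"
        by (intro Ck_on_bilinear[OF _ bounded_bilinear_mult] Ck_on_add Suc.IH Ck_on_const open_UNIV)
    qed simp
  qed
  then show ?thesis
    by (simp add: smooth_on_def)
qed

definition bump :: "'x::real_inner \<Rightarrow> real \<Rightarrow> 'x \<Rightarrow> real" where
  "bump x0 r x = flat_exp 0 (r\<^sup>2 - (x - x0) \<bullet> (x - x0))"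

lemma smooth_on_bump:
  fixes x0 :: "'x::euclidean_space"
  shows "smooth_on (bump x0 r) UNIV"
  unfolding bump_def
  by (rule smooth_on_compose[where T = UNIV])
    (intro smooth_on_flat_exp smooth_on_diff smooth_on_inner smooth_on_const smooth_on_id open_UNIV subset_UNIV)+

lemma bump_center: "r > 0 \<Longrightarrow> bump x0 r x0 > 0"
  by (simp add: bump_def flat_exp_def)

lemma bump_outside: "r > 0 \<Longrightarrow> x \<notin> cball x0 r \<Longrightarrow> bump x0 r x = 0"
proof -
  assume "r > 0" "x \<notin> cball x0 r"
  then have "r \<le> norm (x - x0)"
    by (simp add: dist_norm norm_minus_commute)
  then have "r\<^sup>2 \<le> (x - x0) \<bullet> (x - x0)"
    using \<open>r > 0\<close> by (simp add: dot_square_norm power_mono)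
  then show "bump x0 r x = 0"
    by (simp add: bump_def flat_exp_def)
qed


section \<open>Charts and tangent spaces\<close>

text \<open>Unlike a covector, such a functional may take any values off the tangent space. This covers
  \<open>g p v\<close> and the components of \<open>J p\<close>, about which the definitions say nothing there.\<close>

definition tangent_linear :: "('a, 'n::finite) manifold \<Rightarrow> 'a \<Rightarrow> (('a, 'n) tvec \<Rightarrow> real) \<Rightarrow> bool" where
  "tangent_linear M p L \<longleftrightarrow>
     (\<forall>v\<in>tangent_space M p. \<forall>w\<in>tangent_space M p. L (v + w) = L v + L w) \<and>
     (\<forall>r. \<forall>v\<in>tangent_space M p. L (tscale r v) = r * L v)"

lemma tscale_apply [simp]: "tscale r v c = r *\<^sub>R v c"
  by (simp add: tscale_def)

lemma tscale_zero [simp]: "tscale r 0 = 0"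
  by (simp add: fun_eq_iff)

lemma tscale_zero_left [simp]: "tscale 0 v = 0"
  by (simp add: fun_eq_iff)

lemma sum_fun_apply: "(\<Sum>i\<in>I. f i) x = (\<Sum>i\<in>I. f i x)"
  by (induction I rule: infinite_finite_induct) simp_all

locale smooth_mfd =
  fixes M :: "('a, 'n::finite) manifold"
  assumes smooth_manifold: "smooth_manifold M"
begin

context
  fixes c assumes c: "c \<in> atlas M"
begin

lemma openin_chart_domain: "openin (mtop M) (fst c)"
  and open_chart_image: "open (chart_image c)"
  and homeomorphic_chart: "homeomorphic_map (subtopology (mtop M) (fst c)) (top_of_set (chart_image c)) (snd c)"
  using smooth_manifold c unfolding smooth_manifold_def by blast+

lemma chart_domain_subset: "fst c \<subseteq> carrier M"
  using openin_chart_domain openin_subset by blast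

lemma chart_topspace: "topspace (subtopology (mtop M) (fst c)) = fst c"
  using chart_domain_subset by auto

lemma inj_on_chart: "inj_on (snd c) (fst c)"
  using homeomorphic_imp_injective_map[OF homeomorphic_chart] unfolding chart_topspace .

lemma chart_inv_chart: "p \<in> fst c \<Longrightarrow> chart_inv c (snd c p) = p"
  using inj_on_chart by (simp add: chart_inv_def)

lemma chart_inv_in_domain: "x \<in> chart_image c \<Longrightarrow> chart_inv c x \<in> fst c"
  by (simp add: chart_image_def chart_inv_def inv_into_into)

lemma chart_chart_inv: "x \<in> chart_image c \<Longrightarrow> snd c (chart_inv c x) = x"
  by (simp add: chart_image_def chart_inv_def f_inv_into_f)

lemma chart_in_image: "p \<in> fst c \<Longrightarrow> snd c p \<in> chart_image c"
  by (simp add: chart_image_def)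

lemma open_chart_of_openin:
  assumes "openin (mtop M) U" "U \<subseteq> fst c"
  shows "open (snd c ` U)"
proof -
  have "openin (subtopology (mtop M) (fst c)) U"
    using assms openin_subset_topspace_eq by (metis inf.absorb1 openin_subtopology_Int)
  then have "openin (top_of_set (chart_image c)) (snd c ` U)"
    using homeomorphic_map_openness_eq[OF homeomorphic_chart] by blast
  then show ?thesis
    using open_chart_image openin_open_trans by blast
qed

text \<open>The image under the inverse chart is compact in \<open>M\<close>, hence closed because \<open>M\<close> is Hausdorff.\<close>

lemma closedin_chart_inv_compact:
  assumes "compact K" "K \<subseteq> chart_image c"
  shows "closedin (mtop M) (chart_inv c ` K)"
proof -
  have sub: "chart_inv c ` K \<subseteq> fst c" and img: "snd c ` chart_inv c ` K = K"
    using assms(2) chart_inv_in_domain chart_chart_inv by (auto simp: image_image image_iff subset_iff)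
  have "compactin (top_of_set (chart_image c)) (snd c ` chart_inv c ` K)"
    unfolding img using assms by (simp add: compactin_subtopology)
  then have "compactin (subtopology (mtop M) (fst c)) (chart_inv c ` K)"
    using homeomorphic_map_compactness_eq[OF homeomorphic_chart] sub chart_topspace by blast
  then have "compactin (mtop M) (chart_inv c ` K)"
    by (simp add: compactin_subtopology)
  then show ?thesis
    using compactin_imp_closedin smooth_manifold unfolding smooth_manifold_def by blast
qed

end

lemma carrier_chart: "p \<in> carrier M \<Longrightarrow> \<exists>c\<in>atlas M. p \<in> fst c"
  using smooth_manifold unfolding smooth_manifold_def by blast

lemma charts_at_iff: "c \<in> charts_at M p \<longleftrightarrow> c \<in> atlas M \<and> p \<in> fst c"
  by (simp add: charts_at_def)

lemma open_overlap: "c \<in> atlas M \<Longrightarrow> d \<in> atlas M \<Longrightarrow> open (snd c ` (fst c \<inter> fst d))"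
  by (intro open_chart_of_openin openin_Int openin_chart_domain) auto

lemma smooth_on_transition:
  "c \<in> atlas M \<Longrightarrow> d \<in> atlas M \<Longrightarrow> smooth_on (transition c d) (snd c ` (fst c \<inter> fst d))"
  using smooth_manifold unfolding smooth_manifold_def by blast

lemma transition_chart: "c \<in> atlas M \<Longrightarrow> p \<in> fst c \<Longrightarrow> transition c d (snd c p) = snd d p"
  by (simp add: transition_def chart_inv_chart)

lemma transition_has_derivative:
  assumes "c \<in> charts_at M p" "d \<in> charts_at M p"
  shows "(transition c d has_derivative frechet_derivative (transition c d) (at (snd c p))) (at (snd c p))"
  using assms smooth_on_has_derivative[OF smooth_on_transition] unfolding charts_at_iff by blast

lemma transition_derivative_linear:
  "c \<in> charts_at M p \<Longrightarrow> d \<in> charts_at M p \<Longrightarrow>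
    linear (frechet_derivative (transition c d) (at (snd c p)))"
  using transition_has_derivative has_derivative_linear by blast

lemma transition_derivative_self:
  assumes "c \<in> charts_at M p"
  shows "frechet_derivative (transition c c) (at (snd c p)) = (\<lambda>u. u)"
proof -
  have c: "c \<in> atlas M" "p \<in> fst c"
    using assms by (auto simp: charts_at_iff)
  have "((\<lambda>x. x) has_derivative (\<lambda>u. u)) (at (snd c p))"
    by simp
  then have "(transition c c has_derivative (\<lambda>u. u)) (at (snd c p))"
    by (rule has_derivative_transform_within_open[where s = "chart_image c"])
      (use c open_chart_image in \<open>auto simp: chart_in_image transition_def chart_chart_inv\<close>)
  then show ?thesis
    using frechet_derivative_at by metis
qed

text \<open>The chain rule for \<open>transition d e \<circ> transition c d = transition c e\<close>, valid near \<open>p\<close>.\<close>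

lemma transition_derivative_cocycle:
  assumes "c \<in> charts_at M p" "d \<in> charts_at M p" "e \<in> charts_at M p"
  shows "frechet_derivative (transition d e) (at (snd d p))
      (frechet_derivative (transition c d) (at (snd c p)) u) =
    frechet_derivative (transition c e) (at (snd c p)) u"
proof -
  have c: "c \<in> atlas M" "p \<in> fst c" and d: "d \<in> atlas M" "p \<in> fst d" and e: "e \<in> atlas M" "p \<in> fst e"
    using assms by (auto simp: charts_at_iff)
  have "((\<lambda>x. transition d e (transition c d x)) has_derivative
      (\<lambda>u. frechet_derivative (transition d e) (at (snd d p))
        (frechet_derivative (transition c d) (at (snd c p)) u))) (at (snd c p))"
    by (rule has_derivative_compose[OF transition_has_derivative[OF assms(1,2)]])
      (simp add: transition_chart[OF c] transition_has_derivative[OF assms(2,3)])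
  then have "(transition c e has_derivative
      (\<lambda>u. frechet_derivative (transition d e) (at (snd d p))
        (frechet_derivative (transition c d) (at (snd c p)) u))) (at (snd c p))"
    by (rule has_derivative_transform_within_open[where s = "snd c ` (fst c \<inter> fst d)"])
      (use c d open_overlap in \<open>auto simp: transition_chart\<close>)
  then show ?thesis
    using frechet_derivative_at by metis
qed

lemma tangent_spaceI:
  assumes "\<And>c d. c \<in> charts_at M p \<Longrightarrow> d \<in> charts_at M p \<Longrightarrow>
      frechet_derivative (transition c d) (at (snd c p)) (v c) = v d"
    and "\<And>c. c \<notin> charts_at M p \<Longrightarrow> v c = 0"
  shows "v \<in> tangent_space M p"
  using assms unfolding tangent_space_def by auto

lemma tangent_space_transition:
  assumes "v \<in> tangent_space M p" "c \<in> charts_at M p" "d \<in> charts_at M p"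
  shows "frechet_derivative (transition c d) (at (snd c p)) (v c) = v d"
  using assms unfolding tangent_space_def by fastforce

lemma tangent_space_outside: "v \<in> tangent_space M p \<Longrightarrow> c \<notin> charts_at M p \<Longrightarrow> v c = 0"
  unfolding tangent_space_def by blast

lemma zero_in_tangent_space:
  "0 \<in> tangent_space M p"
  by (rule tangent_spaceI)
    (simp_all add: linear_0[OF transition_derivative_linear] tangent_space_transition tangent_space_outside)

lemma add_in_tangent_space:
  "v \<in> tangent_space M p \<Longrightarrow> w \<in> tangent_space M p \<Longrightarrow> v + w \<in> tangent_space M p"
  by (rule tangent_spaceI)
    (simp_all add: linear_add[OF transition_derivative_linear] tangent_space_transition tangent_space_outside)

lemma tscale_in_tangent_space:
  "v \<in> tangent_space M p \<Longrightarrow> tscale r v \<in> tangent_space M p"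
  by (rule tangent_spaceI)
    (simp_all add: linear_scale[OF transition_derivative_linear] tangent_space_transition tangent_space_outside)

lemma diff_in_tangent_space:
  "v \<in> tangent_space M p \<Longrightarrow> w \<in> tangent_space M p \<Longrightarrow> v - w \<in> tangent_space M p"
  by (rule tangent_spaceI)
    (simp_all add: linear_diff[OF transition_derivative_linear] tangent_space_transition tangent_space_outside)

lemma sum_in_tangent_space:
  "(\<And>i. i \<in> I \<Longrightarrow> f i \<in> tangent_space M p) \<Longrightarrow> (\<Sum>i\<in>I. f i) \<in> tangent_space M p"
  by (induction I rule: infinite_finite_induct) (simp_all add: zero_in_tangent_space add_in_tangent_space)

lemma coord_vec_in_tangent_space:
  assumes "c \<in> charts_at M p"
  shows "coord_vec M c p u \<in> tangent_space M p"
  by (rule tangent_spaceI) (simp_all add: coord_vec_def transition_derivative_cocycle[OF assms])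

lemma coord_vec_chart: "c \<in> charts_at M p \<Longrightarrow> coord_vec M c p u c = u"
  by (simp add: coord_vec_def transition_derivative_self)

lemma coord_vec_of_tangent:
  "c \<in> charts_at M p \<Longrightarrow> v \<in> tangent_space M p \<Longrightarrow> coord_vec M c p (v c) = v"
  by (simp add: coord_vec_def tangent_space_transition tangent_space_outside fun_eq_iff)

lemma tangent_eqI:
  assumes "c \<in> charts_at M p" "v \<in> tangent_space M p" "w \<in> tangent_space M p" "v c = w c"
  shows "v = w"
  using assms coord_vec_of_tangent by metis

lemma tangent_expansion:
  assumes "c \<in> charts_at M p" "v \<in> tangent_space M p"
  shows "v = (\<Sum>i\<in>UNIV. tscale (v c $ i) (coord_vec M c p (axis i 1)))"
proof (rule tangent_eqI[OF assms])
  show "(\<Sum>i\<in>UNIV. tscale (v c $ i) (coord_vec M c p (axis i 1))) \<in> tangent_space M p"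
    using assms(1) by (intro sum_in_tangent_space tscale_in_tangent_space coord_vec_in_tangent_space)
  show "v c = (\<Sum>i\<in>UNIV. tscale (v c $ i) (coord_vec M c p (axis i 1))) c"
    by (simp add: sum_fun_apply coord_vec_chart[OF assms(1)] vec_eq_iff axis_def if_distrib cong: if_cong)
qed

lemma tangent_linear_sum:
  assumes L: "tangent_linear M p L" and "finite I" "\<And>i. i \<in> I \<Longrightarrow> e i \<in> tangent_space M p"
  shows "L (\<Sum>i\<in>I. tscale (a i) (e i)) = (\<Sum>i\<in>I. a i * L (e i))"
  using assms(2,3)
proof (induction I rule: finite_induct)
  case empty
  have "L (tscale 0 0) = 0 * L 0"
    using L zero_in_tangent_space[of p] unfolding tangent_linear_def by blast
  then show ?case
    by (simp add: zero_fun_def)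
next
  case (insert i I)
  have e: "e i \<in> tangent_space M p"
    and rest: "(\<Sum>i\<in>I. tscale (a i) (e i)) \<in> tangent_space M p"
    using insert.prems by (auto intro!: sum_in_tangent_space tscale_in_tangent_space)
  have "L (\<Sum>i\<in>insert i I. tscale (a i) (e i)) = L (tscale (a i) (e i) + (\<Sum>i\<in>I. tscale (a i) (e i)))"
    unfolding sum.insert[OF insert.hyps] ..
  also have "\<dots> = L (tscale (a i) (e i)) + L (\<Sum>i\<in>I. tscale (a i) (e i))"
    using L tscale_in_tangent_space[OF e] rest unfolding tangent_linear_def by blast
  also have "L (tscale (a i) (e i)) = a i * L (e i)"
    using L e unfolding tangent_linear_def by blast
  also have "L (\<Sum>i\<in>I. tscale (a i) (e i)) = (\<Sum>i\<in>I. a i * L (e i))"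
    using insert by blast
  finally show ?case
    unfolding sum.insert[OF insert.hyps] .
qed

lemma tangent_linear_expansion:
  assumes "tangent_linear M p L" "c \<in> charts_at M p" "v \<in> tangent_space M p"
  shows "L v = (\<Sum>i\<in>UNIV. v c $ i * L (coord_vec M c p (axis i 1)))"
proof -
  have "L v = L (\<Sum>i\<in>UNIV. tscale (v c $ i) (coord_vec M c p (axis i 1)))"
    using tangent_expansion[OF assms(2,3)] by simp
  also have "\<dots> = (\<Sum>i\<in>UNIV. v c $ i * L (coord_vec M c p (axis i 1)))"
    by (rule tangent_linear_sum) (auto intro: assms coord_vec_in_tangent_space)
  finally show ?thesis .
qed

section \<open>Smooth sections\<close>

lemma chart_inv_charts_at: "c \<in> atlas M \<Longrightarrow> x \<in> chart_image c \<Longrightarrow> c \<in> charts_at M (chart_inv c x)"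
  by (simp add: charts_at_iff chart_inv_in_domain)

lemma chart_inv_carrier: "c \<in> atlas M \<Longrightarrow> x \<in> chart_image c \<Longrightarrow> chart_inv c x \<in> carrier M"
  using chart_inv_in_domain chart_domain_subset by blast

lemma vector_field_tangent: "X \<in> vector_fields M \<Longrightarrow> p \<in> carrier M \<Longrightarrow> X p \<in> tangent_space M p"
  by (simp add: vector_fields_def)

lemma vector_field_smooth:
  "X \<in> vector_fields M \<Longrightarrow> c \<in> atlas M \<Longrightarrow> smooth_on (\<lambda>x. X (chart_inv c x) c) (chart_image c)"
  by (simp add: vector_fields_def)

lemma vector_field_outside: "X \<in> vector_fields M \<Longrightarrow> p \<notin> carrier M \<Longrightarrow> X p = 0"
  by (simp add: vector_fields_def)

text \<open>Tensoriality turned into smoothness: expanded in the coordinate frame, the pairing is a finite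
  sum of products of coefficients that are smooth by hypothesis. All the smoothness of \<open>J X\<close> and of
  \<open>g(X, _)\<close> comes from here.\<close>

lemma smooth_on_tangent_linear:
  assumes c: "c \<in> atlas M"
    and lin: "\<And>x. x \<in> chart_image c \<Longrightarrow> tangent_linear M (chart_inv c x) (L x)"
    and L: "\<And>u. smooth_on (\<lambda>x. L x (coord_vec M c (chart_inv c x) u)) (chart_image c)"
    and tangent: "\<And>x. x \<in> chart_image c \<Longrightarrow> V x \<in> tangent_space M (chart_inv c x)"
    and V: "smooth_on (\<lambda>x. V x c) (chart_image c)"
  shows "smooth_on (\<lambda>x. L x (V x)) (chart_image c)"
proof (rule smooth_on_cong[OF open_chart_image[OF c]])
  show "smooth_on (\<lambda>x. \<Sum>i\<in>UNIV. V x c $ i * L x (coord_vec M c (chart_inv c x) (axis i 1))) (chart_image c)"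
    using open_chart_image[OF c] by (intro smooth_on_sum smooth_on_mult smooth_on_vec_nth V L)
qed (use tangent_linear_expansion[OF lin chart_inv_charts_at tangent] c in auto)

lemma vector_fields_add: "X \<in> vector_fields M \<Longrightarrow> Y \<in> vector_fields M \<Longrightarrow> X + Y \<in> vector_fields M"
  by (auto simp: vector_fields_def add_in_tangent_space smooth_on_add open_chart_image)

lemma vector_fields_diff: "X \<in> vector_fields M \<Longrightarrow> Y \<in> vector_fields M \<Longrightarrow> X - Y \<in> vector_fields M"
  by (auto simp: vector_fields_def diff_in_tangent_space smooth_on_diff open_chart_image)

lemma vector_fields_scale:
  assumes "f \<in> smooth_functions M" "X \<in> vector_fields M"
  shows "(\<lambda>p. tscale (f p) (X p)) \<in> vector_fields M"
  using assms
  by (auto simp: vector_fields_def smooth_functions_def o_def tscale_in_tangent_space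
      intro!: smooth_on_scaleR open_chart_image)

text \<open>Extend the vector with constant coordinates in a chart and cut it off with a bump function.
  The Hausdorff property makes the compact support of the cut-off closed in \<open>M\<close>, so that the field
  is smooth also in the charts that leave the domain of the first one.\<close>

lemma vector_field_through:
  assumes "p \<in> carrier M" "v \<in> tangent_space M p"
  obtains Y where "Y \<in> vector_fields M" "Y p = v"
proof -
  obtain c where c: "c \<in> atlas M" and p: "p \<in> fst c"
    using carrier_chart[OF assms(1)] by blast
  define x0 where "x0 = snd c p"
  obtain r where r: "r > 0" "cball x0 r \<subseteq> chart_image c"
    using open_contains_cball open_chart_image[OF c] chart_in_image[OF c p] unfolding x0_def by metis
  \<comment> \<open>The bump function has some positive value at the centre, not necessarily \<open>1\<close>.\<close>
  define u where "u = inverse (bump x0 r x0) *\<^sub>R v c"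
  define Y where "Y q = (if q \<in> fst c then tscale (bump x0 r (snd c q)) (coord_vec M c q u) else 0)" for q
  define K where "K = chart_inv c ` cball x0 r"
  have "closedin (mtop M) K"
    unfolding K_def using closedin_chart_inv_compact[OF c _ r(2)] by simp
  have Y_outside: "Y q = 0" if "q \<notin> K" for q
  proof (cases "q \<in> fst c")
    case True
    then have "snd c q \<notin> cball x0 r"
      using that chart_inv_chart[OF c True] unfolding K_def by (metis imageI)
    then have "bump x0 r (snd c q) = 0"
      by (rule bump_outside[OF r(1)])
    then show ?thesis
      by (simp add: Y_def)
  qed (simp add: Y_def)
  have "Y p = v"
  proof (rule tangent_eqI[of c p])
    show "Y p c = v c"
      using p c bump_center[OF r(1), of x0]
      by (simp add: Y_def u_def coord_vec_chart charts_at_iff x0_def[symmetric])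
  qed (use assms c p in \<open>auto simp: Y_def charts_at_iff intro!: tscale_in_tangent_space coord_vec_in_tangent_space\<close>)
  moreover have "Y \<in> vector_fields M"
    unfolding vector_fields_def mem_Collect_eq
  proof (intro conjI ballI allI impI)
    fix q
    show "Y q \<in> tangent_space M q"
      using c by (auto simp: Y_def charts_at_iff zero_in_tangent_space
          intro!: tscale_in_tangent_space coord_vec_in_tangent_space)
    show "Y q = 0" if "q \<notin> carrier M"
      using that chart_domain_subset[OF c] by (auto simp: Y_def)
  next
    fix d assume d: "d \<in> atlas M"
    show "smooth_on (\<lambda>x. Y (chart_inv d x) d) (chart_image d)"
    proof (rule smooth_on_local)
      fix x assume x: "x \<in> chart_image d"
      show "\<exists>U. open U \<and> x \<in> U \<and> smooth_on (\<lambda>x. Y (chart_inv d x) d) U"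
      proof (cases "chart_inv d x \<in> fst c")
        case True
        let ?U = "snd d ` (fst d \<inter> fst c)" and ?W = "snd c ` (fst c \<inter> fst d)"
        let ?T = "transition d c"
        have U: "open ?U" and W: "open ?W"
          using c d open_overlap by auto
        have T: "smooth_on ?T ?U" "?T ` ?U \<subseteq> ?W"
          using smooth_on_transition[OF d c] by (auto simp: transition_chart d)
        have "smooth_on (\<lambda>y. bump x0 r y *\<^sub>R frechet_derivative (transition c d) (at y) u) ?W"
          by (intro smooth_on_scaleR[OF W] smooth_on_frechet_derivative smooth_on_transition c d
              smooth_on_subset[OF smooth_on_bump]) auto
        then have "smooth_on (\<lambda>y. bump x0 r (?T y) *\<^sub>R frechet_derivative (transition c d) (at (?T y)) u) ?U"
          by (rule smooth_on_compose[OF U W T(2,1)])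
        then have "smooth_on (\<lambda>x. Y (chart_inv d x) d) ?U"
          by (rule smooth_on_cong[OF U, rotated])
            (auto simp: Y_def coord_vec_def charts_at_iff c d chart_inv_chart transition_chart)
        moreover have "x \<in> ?U"
          using True x chart_inv_in_domain[OF d x] chart_chart_inv[OF d x] by (metis IntI imageI)
        ultimately show ?thesis
          using U by blast
      next
        case False
        let ?U = "snd d ` (fst d - K)"
        have U: "open ?U"
          using \<open>closedin (mtop M) K\<close> openin_chart_domain[OF d]
          by (intro open_chart_of_openin[OF d] openin_diff) auto
        have "K \<subseteq> fst c"
          using r(2) chart_inv_in_domain[OF c] unfolding K_def by blast
        then have "x \<in> ?U"
          using False x chart_inv_in_domain[OF d x] chart_chart_inv[OF d x]
          by (metis DiffI imageI subsetD)
        moreover have "smooth_on (\<lambda>x. Y (chart_inv d x) d) ?U"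
          by (rule smooth_on_cong[OF U _ smooth_on_const[OF U, of 0]])
            (auto simp: chart_inv_chart[OF d] Y_outside)
        ultimately show ?thesis
          using U by blast
      qed
    qed
  qed
  ultimately show ?thesis
    using that by blast
qed

section \<open>Tensor fields of type \<open>(1,1)\<close> acting on vector fields\<close>

context
  fixes J assumes J: "tensor_field_11 M J"
begin

lemma tensor_tangent: "p \<in> carrier M \<Longrightarrow> v \<in> tangent_space M p \<Longrightarrow> J p v \<in> tangent_space M p"
  and tensor_add: "p \<in> carrier M \<Longrightarrow> v \<in> tangent_space M p \<Longrightarrow> w \<in> tangent_space M p \<Longrightarrow>
    J p (v + w) = J p v + J p w"
  and tensor_tscale: "p \<in> carrier M \<Longrightarrow> v \<in> tangent_space M p \<Longrightarrow> J p (tscale r v) = tscale r (J p v)"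
  using J unfolding tensor_field_11_def by blast+

lemma act_vector_field:
  assumes X: "X \<in> vector_fields M"
  shows "act M J X \<in> vector_fields M"
  unfolding vector_fields_def mem_Collect_eq
proof (intro conjI ballI allI impI)
  fix c assume c: "c \<in> atlas M"
  note opn = open_chart_image[OF c]
  have "smooth_on (\<lambda>x. J (chart_inv c x) (X (chart_inv c x)) c) (chart_image c)"
  proof (rule smooth_on_vecI[OF opn])
    fix j
    show "smooth_on (\<lambda>x. J (chart_inv c x) (X (chart_inv c x)) c $ j) (chart_image c)"
    proof (rule smooth_on_tangent_linear[OF c, where L = "\<lambda>x v. J (chart_inv c x) v c $ j"])
      fix x assume "x \<in> chart_image c"
      then show "tangent_linear M (chart_inv c x) (\<lambda>v. J (chart_inv c x) v c $ j)"
        using c by (simp add: tangent_linear_def tensor_add tensor_tscale chart_inv_carrier)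
    next
      fix u
      show "smooth_on (\<lambda>x. J (chart_inv c x) (coord_vec M c (chart_inv c x) u) c $ j) (chart_image c)"
        using J c unfolding tensor_field_11_def by (intro smooth_on_vec_nth opn) blast
    qed (use X c in \<open>auto intro: vector_field_tangent vector_field_smooth chart_inv_carrier\<close>)
  qed
  then show "smooth_on (\<lambda>x. act M J X (chart_inv c x) c) (chart_image c)"
    by (rule smooth_on_cong[OF opn, rotated]) (use c in \<open>simp add: act_def chart_inv_carrier\<close>)
qed (use X in \<open>auto simp: act_def tensor_tangent vector_field_tangent\<close>)

lemma act_add:
  assumes "X \<in> vector_fields M" "Y \<in> vector_fields M"
  shows "act M J (X + Y) = act M J X + act M J Y"
  using assms by (auto simp: act_def fun_eq_iff tensor_add vector_field_tangent)

lemma act_diff: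
  assumes "X \<in> vector_fields M" "Y \<in> vector_fields M"
  shows "act M J (X - Y) = act M J X - act M J Y"
  using act_add[OF vector_fields_diff[OF assms] assms(2)] by (simp add: eq_diff_eq)

lemma act_scale:
  assumes "X \<in> vector_fields M"
  shows "act M J (\<lambda>p. tscale (f p) (X p)) = (\<lambda>p. tscale (f p) (act M J X p))"
  using assms by (auto simp: act_def fun_eq_iff tensor_tscale vector_field_tangent)

end

section \<open>The musical isomorphism\<close>

context
  fixes g assumes g: "pseudo_Riemannian_metric M g"
begin

lemma metric_sym:
  assumes "p \<in> carrier M" "v \<in> tangent_space M p" "w \<in> tangent_space M p"
  shows "g p v w = g p w v"
  using g assms unfolding pseudo_Riemannian_metric_def by blast

lemma metric_linear_right: "p \<in> carrier M \<Longrightarrow> v \<in> tangent_space M p \<Longrightarrow> tangent_linear M p (g p v)"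
  using g unfolding pseudo_Riemannian_metric_def tangent_linear_def by blast

lemma metric_linear_left:
  assumes "p \<in> carrier M" "w \<in> tangent_space M p"
  shows "tangent_linear M p (\<lambda>v. g p v w)"
  using metric_linear_right[OF assms] metric_sym[OF assms(1) _ assms(2)]
  unfolding tangent_linear_def by (simp add: add_in_tangent_space tscale_in_tangent_space)

lemma metric_nondegenerate:
  "p \<in> carrier M \<Longrightarrow> v \<in> tangent_space M p \<Longrightarrow> (\<And>w. w \<in> tangent_space M p \<Longrightarrow> g p v w = 0) \<Longrightarrow> v = 0"
  using g unfolding pseudo_Riemannian_metric_def by blast

lemma metric_diff_left:
  assumes "p \<in> carrier M" "v \<in> tangent_space M p" "v' \<in> tangent_space M p" "w \<in> tangent_space M p"
  shows "g p (v - v') w = g p v w - g p v' w"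
proof -
  have "g p ((v - v') + v') w = g p (v - v') w + g p v' w"
    using metric_linear_left[OF assms(1,4)] diff_in_tangent_space[OF assms(2,3)] assms(3)
    unfolding tangent_linear_def by blast
  then show ?thesis
    by simp
qed

lemma metric_left_eq:
  assumes p: "p \<in> carrier M" and v: "v \<in> tangent_space M p" "v' \<in> tangent_space M p"
    and eq: "\<And>w. w \<in> tangent_space M p \<Longrightarrow> g p v w = g p v' w"
  shows "v = v'"
proof -
  have "v - v' = 0"
    by (rule metric_nondegenerate[OF p diff_in_tangent_space[OF v]])
      (simp add: metric_diff_left p v eq)
  then show ?thesis
    by simp
qed

text \<open>In coordinates, \<open>g(v, _) = \<eta>\<close> is the linear system with the Gram matrix of the coordinate
  vectors.\<close>

definition gram :: "('a, 'n) chart \<Rightarrow> 'a \<Rightarrow> real ^ 'n ^ 'n" where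
  "gram c p = (\<chi> i j. g p (coord_vec M c p (axis i 1)) (coord_vec M c p (axis j 1)))"

lemma gram_mult:
  assumes p: "p \<in> carrier M" and c: "c \<in> charts_at M p" and v: "v \<in> tangent_space M p"
  shows "(gram c p *v v c) $ i = g p v (coord_vec M c p (axis i 1))"
proof -
  have e: "coord_vec M c p (axis j 1) \<in> tangent_space M p" for j
    using c by (rule coord_vec_in_tangent_space)
  have "g p (coord_vec M c p (axis i 1)) v =
      (\<Sum>j\<in>UNIV. v c $ j * g p (coord_vec M c p (axis i 1)) (coord_vec M c p (axis j 1)))"
    by (rule tangent_linear_expansion[OF metric_linear_right[OF p e] c v])
  then show ?thesis
    using metric_sym[OF p v e]
    by (simp add: gram_def matrix_vector_mult_def mult.commute)
qed

lemma metric_eq_functional_iff: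
  assumes p: "p \<in> carrier M" and c: "c \<in> charts_at M p" and v: "v \<in> tangent_space M p"
    and L: "tangent_linear M p L"
  shows "(\<forall>w\<in>tangent_space M p. g p v w = L w) \<longleftrightarrow>
    gram c p *v v c = (\<chi> i. L (coord_vec M c p (axis i 1)))"
proof
  assume "\<forall>w\<in>tangent_space M p. g p v w = L w"
  then show "gram c p *v v c = (\<chi> i. L (coord_vec M c p (axis i 1)))"
    using coord_vec_in_tangent_space[OF c] by (simp add: vec_eq_iff gram_mult[OF p c v])
next
  assume "gram c p *v v c = (\<chi> i. L (coord_vec M c p (axis i 1)))"
  then have "g p v (coord_vec M c p (axis i 1)) = L (coord_vec M c p (axis i 1))" for i
    by (simp add: vec_eq_iff gram_mult[OF p c v])
  then show "\<forall>w\<in>tangent_space M p. g p v w = L w"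
    using tangent_linear_expansion[OF L c] tangent_linear_expansion[OF metric_linear_right[OF p v] c]
    by simp
qed

lemma invertible_gram:
  assumes p: "p \<in> carrier M" and c: "c \<in> charts_at M p"
  shows "invertible (gram c p)"
proof -
  have "x = 0" if "gram c p *v x = 0" for x
  proof -
    let ?v = "coord_vec M c p x"
    have v: "?v \<in> tangent_space M p" and vc: "?v c = x"
      using c by (auto intro: coord_vec_in_tangent_space coord_vec_chart)
    have "tangent_linear M p (\<lambda>w. 0)"
      by (simp add: tangent_linear_def)
    from metric_eq_functional_iff[OF p c v this] have "\<forall>w\<in>tangent_space M p. g p ?v w = 0"
      using that by (simp add: vc vec_eq_iff)
    then have "?v = 0"
      using metric_nondegenerate[OF p v] by blast
    then show ?thesis
      using vc by simp
  qed
  then show ?thesis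
    unfolding invertible_left_inverse matrix_left_invertible_ker by blast
qed

lemma metric_represents_functional:
  assumes p: "p \<in> carrier M" and L: "tangent_linear M p L"
  shows "\<exists>v\<in>tangent_space M p. \<forall>w\<in>tangent_space M p. g p v w = L w"
proof -
  obtain c where c: "c \<in> charts_at M p"
    using carrier_chart[OF p] charts_at_iff by blast
  obtain B where B: "gram c p ** B = mat 1"
    using invertible_gram[OF p c] unfolding invertible_def by blast
  let ?b = "\<chi> i. L (coord_vec M c p (axis i 1))"
  let ?v = "coord_vec M c p (B *v ?b)"
  have "gram c p *v ?v c = ?b"
    by (simp add: coord_vec_chart[OF c] matrix_vector_mul_assoc B)
  then show ?thesis
    using metric_eq_functional_iff[OF p c coord_vec_in_tangent_space[OF c] L] coord_vec_in_tangent_space[OF c]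
    by blast
qed

lemma smooth_on_metric_coord:
  assumes "c \<in> atlas M"
  shows "smooth_on (\<lambda>x. g (chart_inv c x) (coord_vec M c (chart_inv c x) u)
      (coord_vec M c (chart_inv c x) w)) (chart_image c)"
  using g assms by (simp add: pseudo_Riemannian_metric_def)

lemma flat_one_form:
  assumes X: "X \<in> vector_fields M"
  shows "flat M g X \<in> one_forms M"
  unfolding one_forms_def mem_Collect_eq
proof (intro conjI ballI allI impI)
  fix p assume p: "p \<in> carrier M"
  show "flat M g X p \<in> cotangent_space M p"
    using metric_linear_right[OF p vector_field_tangent[OF X p]] p
    by (simp add: cotangent_space_def flat_def tangent_linear_def add_in_tangent_space tscale_in_tangent_space)
next
  fix c u assume c: "c \<in> atlas M"
  have "smooth_on (\<lambda>x. g (chart_inv c x) (X (chart_inv c x)) (coord_vec M c (chart_inv c x) u)) (chart_image c)"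
    by (rule smooth_on_tangent_linear[OF c, where L = "\<lambda>x v. g (chart_inv c x) v (coord_vec M c (chart_inv c x) u)"])
      (use X c in \<open>auto intro!: vector_field_tangent vector_field_smooth chart_inv_carrier metric_linear_left
        smooth_on_metric_coord coord_vec_in_tangent_space chart_inv_charts_at\<close>)
  then show "smooth_on (\<lambda>x. flat M g X (chart_inv c x) (coord_vec M c (chart_inv c x) u)) (chart_image c)"
    by (rule smooth_on_cong[OF open_chart_image[OF c], rotated])
      (use c in \<open>simp add: flat_def chart_inv_carrier coord_vec_in_tangent_space chart_inv_charts_at\<close>)
qed (simp add: flat_def fun_eq_iff)

lemma flat_inj_on: "inj_on (flat M g) (vector_fields M)"
proof (rule inj_onI, rule ext)
  fix X Y p
  assume X: "X \<in> vector_fields M" and Y: "Y \<in> vector_fields M" and eq: "flat M g X = flat M g Y"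
  show "X p = Y p"
  proof (cases "p \<in> carrier M")
    case True
    show ?thesis
    proof (rule metric_left_eq[OF True vector_field_tangent[OF X True] vector_field_tangent[OF Y True]])
      fix w assume "w \<in> tangent_space M p"
      then show "g p (X p) w = g p (Y p) w"
        using fun_cong[OF fun_cong[OF eq, of p], of w] True by (simp add: flat_def)
    qed
  qed (simp add: vector_field_outside X Y)
qed

text \<open>The vector that represents \<open>\<eta> p\<close> is a tangent vector, hence carries its coordinates in all charts
  at once, so there is nothing to glue; smoothness is then read off in each chart from the linear
  system with the Gram matrix.\<close>

lemma flat_surj:
  assumes \<eta>: "\<eta> \<in> one_forms M"
  obtains X where "X \<in> vector_fields M" "flat M g X = \<eta>"
proof -
  have lin: "tangent_linear M p (\<eta> p)" if "p \<in> carrier M" for p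
    using \<eta> that by (simp add: one_forms_def cotangent_space_def tangent_linear_def)
  have "\<forall>p. \<exists>v. p \<in> carrier M \<longrightarrow> v \<in> tangent_space M p \<and> (\<forall>w\<in>tangent_space M p. g p v w = \<eta> p w)"
    using metric_represents_functional lin by blast
  then obtain V where V: "p \<in> carrier M \<Longrightarrow> V p \<in> tangent_space M p"
      "p \<in> carrier M \<Longrightarrow> \<forall>w\<in>tangent_space M p. g p (V p) w = \<eta> p w" for p
    by metis
  define X where "X p = (if p \<in> carrier M then V p else 0)" for p
  have "X \<in> vector_fields M"
    unfolding vector_fields_def mem_Collect_eq
  proof (intro conjI ballI allI impI)
    fix c assume c: "c \<in> atlas M"
    let ?q = "chart_inv c"
    show "smooth_on (\<lambda>x. X (?q x) c) (chart_image c)"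
    proof (rule smooth_on_linear_solution[OF open_chart_image[OF c]])
      show "smooth_on (\<lambda>x. gram c (?q x) $ i $ j) (chart_image c)" for i j
        using smooth_on_metric_coord[OF c] by (simp add: gram_def)
      show "smooth_on (\<lambda>x. (\<chi> i. \<eta> (?q x) (coord_vec M c (?q x) (axis i 1))) $ i) (chart_image c)" for i
        using \<eta> c by (simp add: one_forms_def)
    next
      fix x assume "x \<in> chart_image c"
      then have q: "?q x \<in> carrier M" "c \<in> charts_at M (?q x)"
        using c chart_inv_carrier chart_inv_charts_at by auto
      show "det (gram c (?q x)) \<noteq> 0"
        using invertible_gram[OF q] invertible_det_nz by blast
      show "gram c (?q x) *v X (?q x) c = (\<chi> i. \<eta> (?q x) (coord_vec M c (?q x) (axis i 1)))"
        using metric_eq_functional_iff[OF q V(1)[OF q(1)] lin[OF q(1)]] V(2)[OF q(1)] q(1)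
        by (simp add: X_def)
    qed
  qed (use V in \<open>auto simp: X_def\<close>)
  moreover have "flat M g X = \<eta>"
  proof (intro ext)
    fix p v
    show "flat M g X p v = \<eta> p v"
      using V[of p] \<eta> by (cases "p \<in> carrier M"; cases "v \<in> tangent_space M p")
        (auto simp: flat_def X_def one_forms_def cotangent_space_def)
  qed
  ultimately show ?thesis
    using that by blast
qed

lemma sharp_flat: "X \<in> vector_fields M \<Longrightarrow> sharp M g (flat M g X) = X"
  unfolding sharp_def by (rule inv_into_f_f[OF flat_inj_on])

lemma flat_add:
  assumes "X \<in> vector_fields M" "Y \<in> vector_fields M"
  shows "flat M g (X + Y) = flat M g X + flat M g Y"
proof (intro ext)
  fix p v
  show "flat M g (X + Y) p v = (flat M g X + flat M g Y) p v"
    using metric_linear_left[of p v] vector_field_tangent[OF assms(1), of p] vector_field_tangent[OF assms(2), of p]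
    by (simp add: flat_def tangent_linear_def)
qed

lemma flat_scale:
  assumes "X \<in> vector_fields M"
  shows "flat M g (\<lambda>p. tscale (f p) (X p)) = (\<lambda>p v. f p * flat M g X p v)"
proof (intro ext)
  fix p v
  show "flat M g (\<lambda>p. tscale (f p) (X p)) p v = f p * flat M g X p v"
    using metric_linear_left[of p v] vector_field_tangent[OF assms, of p]
    by (simp add: flat_def tangent_linear_def)
qed

text \<open>Both sides are covectors; to compare them on a tangent vector \<open>v\<close>, extend \<open>v\<close> to a global
  vector field, to which self-adjointness applies.\<close>

lemma dual_act_flat:
  assumes J: "tensor_field_11 M J"
    and sym: "\<forall>X\<in>vector_fields M. \<forall>Y\<in>vector_fields M. \<forall>p\<in>carrier M.
      g p (act M J X p) (Y p) = g p (X p) (act M J Y p)"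
    and X: "X \<in> vector_fields M"
  shows "dual_act M J (flat M g X) = flat M g (act M J X)"
proof (intro ext)
  fix p v
  show "dual_act M J (flat M g X) p v = flat M g (act M J X) p v"
  proof (cases "p \<in> carrier M \<and> v \<in> tangent_space M p")
    case True
    then obtain Y where Y: "Y \<in> vector_fields M" "Y p = v"
      using vector_field_through by blast
    have "g p (act M J X p) v = g p (X p) (J p v)"
      using sym X Y True by (force simp: act_def)
    then show ?thesis
      using True tensor_tangent[OF J] by (simp add: dual_act_def flat_def)
  qed (auto simp: dual_act_def flat_def)
qed

end

end

section \<open>The cubic equation\<close>

text \<open>The identity \<open>A\<^sup>3 = A + I\<close> for \<open>A = (a, 1 - a b - a\<^sup>2 - b\<^sup>2; 1, b)\<close>. The operators are additive on
  \<open>V\<close> only, so the proof compares normal forms in place of citing Cayley--Hamilton: \<open>a\<close> is moved to the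
  left of \<open>b\<close>, and the cubic equation eliminates \<open>b\<^sup>3\<close>.\<close>

lemma block_cubic:
  fixes a b :: "'v::ab_group_add \<Rightarrow> 'v"
  assumes add: "\<And>x y. x \<in> V \<Longrightarrow> y \<in> V \<Longrightarrow> x + y \<in> V" and diff: "\<And>x y. x \<in> V \<Longrightarrow> y \<in> V \<Longrightarrow> x - y \<in> V"
    and a: "\<And>x. x \<in> V \<Longrightarrow> a x \<in> V" "\<And>x y. x \<in> V \<Longrightarrow> y \<in> V \<Longrightarrow> a (x + y) = a x + a y"
      "\<And>x y. x \<in> V \<Longrightarrow> y \<in> V \<Longrightarrow> a (x - y) = a x - a y"
    and b: "\<And>x. x \<in> V \<Longrightarrow> b x \<in> V" "\<And>x y. x \<in> V \<Longrightarrow> y \<in> V \<Longrightarrow> b (x + y) = b x + b y"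
      "\<And>x y. x \<in> V \<Longrightarrow> y \<in> V \<Longrightarrow> b (x - y) = b x - b y"
    and comm: "\<And>x. x \<in> V \<Longrightarrow> a (b x) = b (a x)"
    and cubic: "\<And>x. x \<in> V \<Longrightarrow> ((a + b) ^^ 3) x - (a + b) x + x = 0"
    and F: "\<And>x z. x \<in> V \<Longrightarrow> z \<in> V \<Longrightarrow>
      F (x, z) = (a x + (z - a (b z) - a (a z) - b (b z)), x + b z)"
    and x: "x \<in> V" and z: "z \<in> V"
  shows "F (F (F (x, z))) = F (x, z) + (x, z)"
proof -
  have comm': "b (a x) = a (b x)" if "x \<in> V" for x
    using comm[OF that] by simp
  have b3: "b (b (b x)) = a x + b x - x - a (a (a x))
      - (a (a (b x)) + a (a (b x)) + a (a (b x))) - (a (b (b x)) + a (b (b x)) + a (b (b x)))"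
    if x: "x \<in> V" for x
    using cubic[OF x] x
    by (simp add: numeral_3_eq_3 add a b comm' algebra_simps eq_neg_iff_add_eq_0)
  show ?thesis
    using x z by (simp add: F add diff a b comm' b3 algebra_simps)
qed

section \<open>The generalized almost plastic structure\<close>

theorem proposition3p5:
  fixes M :: "('a, 'n::finite) manifold"
    and g :: "'a \<Rightarrow> ('a, 'n) tvec \<Rightarrow> ('a, 'n) tvec \<Rightarrow> real"
    and J\<^sub>1 J\<^sub>2 :: "'a \<Rightarrow> ('a, 'n) tvec \<Rightarrow> ('a, 'n) tvec"
  assumes "smooth_manifold M" and "pseudo_Riemannian_metric M g"
    and "tensor_field_11 M J\<^sub>1" and "tensor_field_11 M J\<^sub>2"
    and "\<forall>X\<in>vector_fields M. act M J\<^sub>1 (act M J\<^sub>2 X) = act M J\<^sub>2 (act M J\<^sub>1 X)"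
    and "\<forall>X\<in>vector_fields M.
      ((act M J\<^sub>1 + act M J\<^sub>2) ^^ 3) X - (act M J\<^sub>1 + act M J\<^sub>2) X + X = 0"
    and "\<forall>X\<in>vector_fields M. \<forall>Y\<in>vector_fields M. \<forall>p\<in>carrier M.
      g p (act M J\<^sub>1 X p) (Y p) = g p (X p) (act M J\<^sub>1 Y p)"
    and "\<forall>X\<in>vector_fields M. \<forall>Y\<in>vector_fields M. \<forall>p\<in>carrier M.
      g p (act M J\<^sub>2 X p) (Y p) = g p (X p) (act M J\<^sub>2 Y p)"
  shows "generalized_almost_plastic M
    (block_matrix
      (act M J\<^sub>1)
      ((id - (act M J\<^sub>1 \<circ> act M J\<^sub>2) - (act M J\<^sub>1 ^^ 2) - (act M J\<^sub>2 ^^ 2)) \<circ> sharp M g)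
      (flat M g)
      (dual_act M J\<^sub>2))"
proof -
  interpret smooth_mfd M
    using assms(1) by unfold_locales
  note g = assms(2)
  let ?V = "vector_fields M"
  define a where "a = act M J\<^sub>1"
  define b where "b = act M J\<^sub>2"
  define P where "P Z = Z - a (b Z) - a (a Z) - b (b Z)" for Z
  define F where "F = block_matrix a ((id - (a \<circ> b) - (a ^^ 2) - (b ^^ 2)) \<circ> sharp M g)
      (flat M g) (dual_act M J\<^sub>2)"
  have a: "a X \<in> ?V" "Y \<in> ?V \<Longrightarrow> a (X + Y) = a X + a Y" "Y \<in> ?V \<Longrightarrow> a (X - Y) = a X - a Y"
      "a (\<lambda>p. tscale (f p) (X p)) = (\<lambda>p. tscale (f p) (a X p))"
    if "X \<in> ?V" for X Y f
    unfolding a_def using that assms(3) by (simp_all add: act_vector_field act_add act_diff act_scale)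
  have b: "b X \<in> ?V" "Y \<in> ?V \<Longrightarrow> b (X + Y) = b X + b Y" "Y \<in> ?V \<Longrightarrow> b (X - Y) = b X - b Y"
      "b (\<lambda>p. tscale (f p) (X p)) = (\<lambda>p. tscale (f p) (b X p))"
    if "X \<in> ?V" for X Y f
    unfolding b_def using that assms(4) by (simp_all add: act_vector_field act_add act_diff act_scale)
  have P: "P Z \<in> ?V" if "Z \<in> ?V" for Z
    using that by (simp add: P_def a b vector_fields_diff)
  have F: "F (X, flat M g Z) = (a X + P Z, flat M g (X + b Z))" if "X \<in> ?V" "Z \<in> ?V" for X Z
    using that dual_act_flat[OF g assms(4,8)] flat_add[OF g that(1) b(1)[OF that(2)]]
    by (simp add: F_def P_def block_matrix_def sharp_flat[OF g] numeral_2_eq_2 b_def)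
  have gsections_flat: "\<exists>X\<in>?V. \<exists>Z\<in>?V. s = (X, flat M g Z)" if "s \<in> gsections M" for s
    using that flat_surj[OF g] unfolding gsections_def by (metis mem_Sigma_iff prod.collapse)
  have flat_gsections: "(X, flat M g Z) \<in> gsections M" if "X \<in> ?V" "Z \<in> ?V" for X Z
    using that flat_one_form[OF g] by (simp add: gsections_def)
  have "F \<in> gsections M \<rightarrow> gsections M"
  proof
    fix s assume "s \<in> gsections M"
    then obtain X Z where s: "X \<in> ?V" "Z \<in> ?V" "s = (X, flat M g Z)"
      using gsections_flat by blast
    then show "F s \<in> gsections M"
      by (simp add: F flat_gsections vector_fields_add a b P)
  qed
  moreover have "F (s + t) = F s + F t" if st: "s \<in> gsections M" "t \<in> gsections M" for s t
  proof -
    obtain X Z where s: "X \<in> ?V" "Z \<in> ?V" "s = (X, flat M g Z)"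
      using gsections_flat[OF st(1)] by blast
    obtain X' Z' where t: "X' \<in> ?V" "Z' \<in> ?V" "t = (X', flat M g Z')"
      using gsections_flat[OF st(2)] by blast
    have "s + t = (X + X', flat M g (Z + Z'))"
      by (simp add: s t flat_add[OF g])
    then have "F (s + t) = (a (X + X') + P (Z + Z'), flat M g ((X + X') + b (Z + Z')))"
      using s t by (simp add: F vector_fields_add)
    also have "a (X + X') = a X + a X'"
      using s t by (intro a)
    also have "P (Z + Z') = P Z + P Z'"
      using s t by (simp add: P_def a b)
    also have "(X + X') + b (Z + Z') = (X + b Z) + (X' + b Z')"
      using s t by (simp add: b)
    also have "flat M g \<dots> = flat M g (X + b Z) + flat M g (X' + b Z')"
      using s t by (intro flat_add[OF g] vector_fields_add b) auto
    finally show ?thesis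
      using F[OF s(1,2)] F[OF t(1,2)] by (simp add: s(3) t(3) fun_eq_iff algebra_simps)
  qed
  moreover have "F (gscale f s) = gscale f (F s)" if f: "f \<in> smooth_functions M" and gs: "s \<in> gsections M" for f s
  proof -
    let ?f = "\<lambda>X p. tscale (f p) (X p) :: ('a, 'n) tvec"
    obtain X Z where s: "X \<in> ?V" "Z \<in> ?V" "s = (X, flat M g Z)"
      using gsections_flat[OF gs] by blast
    have V: "?f Y \<in> ?V" if "Y \<in> ?V" for Y
      using vector_fields_scale[OF f that] .
    have gscale_flat: "gscale f (Y, flat M g Y') = (?f Y, flat M g (?f Y'))" if "Y' \<in> ?V" for Y Y'
      using that by (simp add: gscale_def flat_scale[OF g])
    have "F (gscale f s) = (a (?f X) + P (?f Z), flat M g (?f X + b (?f Z)))"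
      using s by (simp add: gscale_flat F V)
    also have "a (?f X) + P (?f Z) = ?f (a X + P Z)"
      using s by (simp add: P_def a b fun_eq_iff algebra_simps)
    also have "?f X + b (?f Z) = ?f (X + b Z)"
      using s by (simp add: b fun_eq_iff algebra_simps)
    finally show ?thesis
      unfolding s(3) F[OF s(1,2)] gscale_flat[OF vector_fields_add[OF s(1) b(1)[OF s(2)]]] .
  qed
  moreover have "(F ^^ 3) s - F s - s = 0" if gs: "s \<in> gsections M" for s
  proof -
    obtain X Z where s: "X \<in> ?V" "Z \<in> ?V" "s = (X, flat M g Z)"
      using gsections_flat[OF gs] by blast
    \<comment> \<open>\<open>G\<close> is the block matrix in terms of pairs of vector fields, and \<open>\<phi>\<close> identifies those pairs
      with sections.\<close>
    define G where "G = (\<lambda>(X, Z). (a X + P Z, X + b Z))"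
    define \<phi> where "\<phi> = (\<lambda>(X::'a \<Rightarrow> ('a, 'n) tvec, Z). (X, flat M g Z))"
    have G: "G t \<in> ?V \<times> ?V" and FG: "F (\<phi> t) = \<phi> (G t)" if "t \<in> ?V \<times> ?V" for t
      using that by (auto simp: G_def \<phi>_def F a b P vector_fields_add)
    have t: "(X, Z) \<in> ?V \<times> ?V"
      using s by simp
    have "(F ^^ 3) s = \<phi> (G (G (G (X, Z))))"
      using s(3) FG[OF t] FG[OF G[OF t]] FG[OF G[OF G[OF t]]] by (simp add: numeral_3_eq_3 \<phi>_def)
    also have "G (G (G (X, Z))) = G (X, Z) + (X, Z)"
    proof (rule block_cubic[where V = ?V and a = a and b = b])
      show "a (b Y) = b (a Y)" "((a + b) ^^ 3) Y - (a + b) Y + Y = 0" if "Y \<in> ?V" for Y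
        using that assms(5,6) unfolding a_def b_def by blast+
    qed (use s in \<open>auto simp: a b vector_fields_add vector_fields_diff G_def P_def\<close>)
    also have "\<phi> \<dots> = F s + s"
      using s by (simp add: \<phi>_def G_def F flat_add[OF g] vector_fields_add b)
    finally show ?thesis
      by simp
  qed
  ultimately show ?thesis
    unfolding generalized_almost_plastic_def gmorphism_def F_def a_def b_def by blast
qed

end
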